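(* Let $k\ge1$ and $n-2k\ge4$, and let $\mu_1$ be the $n$-dimensional Leibniz algebra over $\mathbb{C}$ with basis $\{e_1,\dots,e_{n-2k},f_1,\dots,f_{2k}\}$ and products $[e_i,e_1]=e_{i+1}$ ($1\le i\le n-2k-1$), $[e_1,f_j]=f_{k+j}$ ($1\le j\le k$), other products zero. Let $R$ be a solvable Leibniz algebra over $\mathbb{C}$ of dimension $n+1$ with nilradical $\mu_1$ and let $x$ span a complement of $\mu_1$ in $R$. Let $\mathcal{F}=\operatorname{span}\{f_1,\dots,f_k\}$ and let $\varepsilon(\mathcal{R}_x|_{\mathcal{F}}):\mathcal{F}\to\mathcal{F}$ be the composition of $\mathcal{R}_x|_{\mathcal{F}}$ with the projection onto $\mathcal{F}$ along the span of the remaining basis vectors of $\mu_1$. Assume that there is a basis of $\mathcal{F}$ in which $\varepsilon(\mathcal{R}_x|_{\mathcal{F}})$ is a single Jordan block $J_\lambda$ with $\lambda\neq0$. Then there exist $a_2,\dots,a_{n-2k+1}\in\mathbb{C}$ and a basis $\{e_1,\dots,e_{n-2k},f_1,\dots,f_{2k},x\}$ of $R$ in which the multiplication table is $$\begin{array}{ll} [e_i,e_1]=e_{i+1},&1\le i\le n-2k-1,\\ {}[e_1,f_i]=f_{k+i},&1\le i\le k,\\ {}[e_i,x]=\sum_{j=i+1}^{n-2k}a_{j-i+1}e_j,&1\le i\le n-2k,\\ {}[f_i,x]=f_i+f_{i+1},&1\le i\le k-1,\\ {}[f_k,x]=f_k,&\\ {}[f_i,x]=f_i+f_{i+1},&k+1\le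 i\le 2k-1,\\ {}[f_{2k},x]=f_{2k},&\\ {}[x,f_i]=-f_i-f_{i+1},&1\le i\le k-1,\\ {}[x,f_k]=-f_k,&\\ {}[x,x]=a_{n-2k+1}e_{n-2k},& \end{array}$$ all products of basis elements not listed being zero.
   Context: All algebras are finite-dimensional over $\mathbb{C}$. A (right) Leibniz algebra is a vector space $L$ with a bilinear bracket satisfying $[x,[y,z]]=[[x,y],z]-[[x,z],y]$ for all $x,y,z\in L$. $L$ is solvable if its derived series $L^{[1]}=L$, $L^{[j+1]}=[L^{[j]},L^{[j]}]$ reaches $0$, nilpotent if its lower central series $L^1=L$, $L^{j+1}=[L^j,L]$ reaches $0$. The nilradical is the maximal nilpotent ideal. $\mathcal{R}_x$ denotes right multiplication, $\mathcal{R}_x(y)=[y,x]$; it maps the nilradical to itself. An empty sum is $0$. *)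

theory Defs
  imports Complex_Main "Jordan_Normal_Form.Jordan_Normal_Form"
begin

context vector_space
begin

definition ordered_basis :: "'b list \<Rightarrow> 'b set \<Rightarrow> bool" where
  "ordered_basis bs S \<longleftrightarrow> distinct bs \<and> independent (set bs) \<and> span (set bs) = S"

definition complementary :: "'b set \<Rightarrow> 'b set \<Rightarrow> bool" where
  "complementary U W \<longleftrightarrow>
     subspace U \<and> subspace W \<and> U \<inter> W = {0} \<and> (\<forall>v. \<exists>u\<in>U. \<exists>w\<in>W. v = u + w)"

text \<open>Meaningful for \<open>v\<close> in the direct sum of \<open>U\<close> and \<open>W\<close>, which need not be the whole space.\<close>
definition projection_along :: "'b set \<Rightarrow> 'b set \<Rightarrow> 'b \<Rightarrow> 'b" where
  "projection_along U W v = (THE u. u \<in> U \<and> v - u \<in> W)"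

text \<open>Columns are images of basis vectors, so \<open>jordan_block\<close> (ones above the diagonal)
  means \<open>T (bs ! 0) = c *s bs ! 0\<close> and \<open>T (bs ! j) = bs ! (j - 1) + c *s bs ! j\<close> for
  \<open>j > 0\<close>; the other convention amounts to reversing the basis.\<close>
definition matrix_in_basis :: "('b \<Rightarrow> 'b) \<Rightarrow> 'b list \<Rightarrow> 'a mat \<Rightarrow> bool" where
  "matrix_in_basis T bs A \<longleftrightarrow>
     A \<in> carrier_mat (length bs) (length bs) \<and>
     (\<forall>j < length bs. T (bs ! j) = (\<Sum>i<length bs. A $$ (i, j) *s bs ! i))"

end

text \<open>Right Leibniz algebras; the underlying vector space is the whole type \<open>'b\<close>.\<close>
locale leibniz_algebra = vector_space scale
  for scale :: "'a::field \<Rightarrow> 'b::ab_group_add \<Rightarrow> 'b" (infixr \<open>*s\<close> 75) +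
  fixes br :: "'b \<Rightarrow> 'b \<Rightarrow> 'b"
  assumes finite_dimensional: "\<exists>B. finite B \<and> span B = UNIV"
    and linear_left: "\<And>y. Vector_Spaces.linear scale scale (\<lambda>x. br x y)"
    and linear_right: "\<And>x. Vector_Spaces.linear scale scale (\<lambda>y. br x y)"
    and leibniz_identity: "\<And>x y z. br x (br y z) = br (br x y) z - br (br x z) y"
begin

definition product_space :: "'b set \<Rightarrow> 'b set \<Rightarrow> 'b set" where
  "product_space U V = span {br u v | u v. u \<in> U \<and> v \<in> V}"

text \<open>Both series start at index 0, i.e. index \<open>j\<close> is the term usually numbered \<open>j + 1\<close>.\<close>
primrec derived_series :: "nat \<Rightarrow> 'b set" where
  "derived_series 0 = UNIV"
| "derived_series (Suc j) = product_space (derived_series j) (derived_series j)"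

definition solvable :: bool where
  "solvable \<longleftrightarrow> (\<exists>j. derived_series j = {0})"

primrec lower_central_series :: "'b set \<Rightarrow> nat \<Rightarrow> 'b set" where
  "lower_central_series S 0 = S"
| "lower_central_series S (Suc j) = product_space (lower_central_series S j) S"

definition nilpotent_on :: "'b set \<Rightarrow> bool" where
  "nilpotent_on S \<longleftrightarrow> (\<exists>j. lower_central_series S j = {0})"

definition leibniz_ideal :: "'b set \<Rightarrow> bool" where
  "leibniz_ideal I \<longleftrightarrow> subspace I \<and> (\<forall>y\<in>I. \<forall>z. br y z \<in> I \<and> br z y \<in> I)"

definition is_nilradical :: "'b set \<Rightarrow> bool" where
  "is_nilradical N \<longleftrightarrow>
     leibniz_ideal N \<and> nilpotent_on N \<and>
     (\<forall>M. leibniz_ideal M \<and> nilpotent_on M \<longrightarrow> M \<subseteq> N)"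

definition right_mult :: "'b \<Rightarrow> 'b \<Rightarrow> 'b" where
  "right_mult x y = br y x"

text \<open>In the two tables \<open>m\<close> is the number of vectors \<open>e\<^sub>i\<close>; indices start at 1 and values of
  \<open>e\<close>, \<open>f\<close> (and \<open>a\<close>) outside the displayed ranges are irrelevant.\<close>
definition mu1_table :: "nat \<Rightarrow> nat \<Rightarrow> (nat \<Rightarrow> 'b) \<Rightarrow> (nat \<Rightarrow> 'b) \<Rightarrow> bool" where
  "mu1_table m k e f \<longleftrightarrow>
     (\<forall>i\<in>{1..m}. \<forall>j\<in>{1..m}. br (e i) (e j) = (if j = 1 \<and> i < m then e (i + 1) else 0)) \<and>
     (\<forall>i\<in>{1..m}. \<forall>j\<in>{1..2*k}. br (e i) (f j) = (if i = 1 \<and> j \<le> k then f (k + j) else 0)) \<and>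
     (\<forall>i\<in>{1..2*k}. \<forall>j\<in>{1..m}. br (f i) (e j) = 0) \<and>
     (\<forall>i\<in>{1..2*k}. \<forall>j\<in>{1..2*k}. br (f i) (f j) = 0)"

definition extension_table ::
  "nat \<Rightarrow> nat \<Rightarrow> (nat \<Rightarrow> 'a) \<Rightarrow> (nat \<Rightarrow> 'b) \<Rightarrow> (nat \<Rightarrow> 'b) \<Rightarrow> 'b \<Rightarrow> bool" where
  "extension_table m k a e f x \<longleftrightarrow>
     mu1_table m k e f \<and>
     (\<forall>i\<in>{1..m}. br (e i) x = (\<Sum>j=i+1..m. a (j - i + 1) *s e j)) \<and>
     (\<forall>i\<in>{1..k-1}. br (f i) x = f i + f (i + 1)) \<and>
     br (f k) x = f k \<and>
     (\<forall>i\<in>{k+1..2*k-1}. br (f i) x = f i + f (i + 1)) \<and>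
     br (f (2*k)) x = f (2*k) \<and>
     (\<forall>i\<in>{1..k-1}. br x (f i) = - f i - f (i + 1)) \<and>
     br x (f k) = - f k \<and>
     br x x = a (m + 1) *s e m \<and>
     (\<forall>i\<in>{1..m}. br x (e i) = 0) \<and>
     (\<forall>i\<in>{k+1..2*k}. br x (f i) = 0)"

end

end

theory Submission
  imports Defs
begin

text \<open>
  Write \<open>m = n - 2k\<close>, \<open>R\<^sub>x u = [u,x]\<close> and \<open>L\<^sub>x u = [x,u]\<close>. The map \<open>R\<^sub>x\<close> is a derivation of the nilradical
  \<open>N\<close>, and \<open>[u,x] + [x,u]\<close> annihilates \<open>N\<close> from the right, so on \<open>N\<close> the map \<open>L\<^sub>x\<close> equals \<open>-R\<^sub>x\<close> up to
  the span \<open>B\<close> of \<open>e\<^sub>2, \<dots>, e\<^sub>m, f\<^sub>k\<^sub>+\<^sub>1, \<dots>, f\<^sub>2\<^sub>k\<close>; moreover \<open>L\<^sub>x\<close> kills \<open>B\<close>. Expanding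
  \<open>[x,[f\<^sub>1,e\<^sub>1]] = 0\<close> shows that the \<open>e\<^sub>1\<close>-coefficients of \<open>[x,e\<^sub>1]\<close> and \<open>[e\<^sub>1,x]\<close> vanish
  (\<open>br_x_e1\<close>, \<open>br_e1_x\<close>). Hence \<open>R\<^sub>x\<close> is nilpotent in the \<open>e\<close>-direction, while it acts on \<open>f\<^sub>1, \<dots>, f\<^sub>k\<close>
  by the given Jordan block, modulo \<open>e\<^sub>m\<close> and \<open>G\<close>, the span of \<open>f\<^sub>k\<^sub>+\<^sub>1, \<dots>, f\<^sub>2\<^sub>k\<close>, and on \<open>G\<close>, through
  \<open>[e\<^sub>1,-]\<close>, by the same block. Dividing \<open>x\<close> by the eigenvalue and rescaling the Jordan basis in
  reverse order makes this block unipotent with ones off the diagonal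
  (\<open>jordan_extension_if_projection\<close>).

  The table is then reached by three changes of basis. Since \<open>R\<^sub>x\<close> is invertible on the \<open>f\<close>-part
  modulo \<open>e\<^sub>m\<close>, some \<open>e\<^sub>1 + w\<close> with \<open>w\<close> in that part generates \<open>e\<close>-vectors whose span contains its
  image under \<open>R\<^sub>x\<close> (\<open>normalise_e1\<close>). Subtracting a combination of the \<open>e\<^sub>i\<close> from \<open>x\<close> cancels the
  \<open>e\<close>-part of \<open>[x,e\<^sub>1]\<close>; the Leibniz identity for \<open>x, e\<^sub>1, x\<close> forces the rest to vanish and \<open>[x,x]\<close> into the span of \<open>e\<^sub>m\<close> and
  \<open>G\<close>, and the \<open>G\<close>-part of \<open>[x,x]\<close> is absorbed into \<open>x\<close> (\<open>normalise_x\<close>). Finally, nothing so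
  far controls the \<open>G\<close>-part of \<open>[f\<^sub>j,x]\<close>. Here left multiplication helps: it commutes with \<open>R\<^sub>x\<close> on the
  \<open>f\<^sub>j\<close> and kills \<open>e\<^sub>m\<close> and \<open>G\<close>, so replacing \<open>f\<^sub>j\<close> by \<open>[x,f\<^sub>j]\<close> removes all the unwanted
  components of \<open>[f\<^sub>j,x]\<close> and \<open>[x,f\<^sub>j]\<close> at once (\<open>extension_table_if_normalised\<close>).
\<close>

section \<open>Spanning families of minimal size\<close>

context vector_space
begin

lemma independent_if_spanning_card_le_dim:
  assumes "finite S" "span S = UNIV" "card S \<le> dim (UNIV :: 'b set)"
  shows "independent S"
proof -
  obtain A where A: "A \<subseteq> S" "independent A" "S \<subseteq> span A"
    using maximal_independent_subset[of S] by blast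
  have "span A = UNIV"
    using A(3) assms(2) span_minimal[OF A(3) subspace_span] by blast
  then have "card A = dim (UNIV :: 'b set)"
    using A(2) basis_card_eq_dim[of A UNIV] by simp
  then have "A = S"
    using A(1) assms(1,3) by (metis card_seteq)
  then show ?thesis using A(2) by simp
qed

lemma ordered_basis_if_spanning_length_dim:
  assumes "span (set bs) = UNIV" "length bs = dim (UNIV :: 'b set)"
  shows "ordered_basis bs UNIV"
proof -
  have "independent (set bs)"
    using assms card_length[of bs] by (intro independent_if_spanning_card_le_dim) auto
  moreover have "dim (UNIV :: 'b set) \<le> card (set bs)"
    using assms(1) by (intro dim_le_card) auto
  then have "distinct bs"
    using assms(2) card_length[of bs] by (intro card_distinct) linarith
  ultimately show ?thesis
    using assms(1) by (simp add: ordered_basis_def)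
qed

lemma independent_family_coeffs_zero:
  assumes "inj_on p I" "finite I" "independent (p ` I)"
    and "(\<Sum>i\<in>I. c i *s p i) = 0" and "i \<in> I"
  shows "c i = 0"
proof -
  have "(\<Sum>v\<in>p ` I. c (the_inv_into I p v) *s v) = (\<Sum>i\<in>I. c (the_inv_into I p (p i)) *s p i)"
    using assms(1) by (simp add: sum.reindex)
  also have "\<dots> = 0"
    using assms(1,4) by (simp add: the_inv_into_f_f cong: sum.cong)
  finally have "(\<Sum>v\<in>p ` I. c (the_inv_into I p v) *s v) = 0" .
  then have "c (the_inv_into I p (p i)) = 0"
    by (rule independentD[OF assms(3) finite_imageI[OF assms(2)] subset_refl]) (use assms(5) in simp)
  then show ?thesis
    using assms(1,5) by (simp add: the_inv_into_f_f)
qed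

lemma in_span_image_iff:
  assumes "finite I"
  shows "v \<in> span (p ` I) \<longleftrightarrow> (\<exists>c. v = (\<Sum>i\<in>I. c i *s p i))"
proof
  assume "v \<in> span (p ` I)"
  then show "\<exists>c. v = (\<Sum>i\<in>I. c i *s p i)"
  proof (induction rule: span_induct_alt)
    case base
    show ?case by (rule exI[of _ "\<lambda>_. 0"]) simp
  next
    case (step a b w)
    then obtain c i where c: "w = (\<Sum>i\<in>I. c i *s p i)" and i: "i \<in> I" "b = p i" by blast
    have "a *s b + w = (\<Sum>j\<in>I. (if j = i then a *s p j else 0)) + (\<Sum>j\<in>I. c j *s p j)"
      using assms i c by simp
    also have "\<dots> = (\<Sum>j\<in>I. ((if j = i then a else 0) + c j) *s p j)"
      by (subst sum.distrib[symmetric], rule sum.cong) (auto simp: scale_left_distrib)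
    finally show ?case by (intro exI)
  qed
next
  assume "\<exists>c. v = (\<Sum>i\<in>I. c i *s p i)"
  then show "v \<in> span (p ` I)"
    by (auto intro!: span_sum span_scale intro: span_base)
qed

text \<open>Back substitution for a unipotent bidiagonal system.\<close>
lemma mem_subspace_if_consecutive_sums:
  fixes h :: "nat \<Rightarrow> 'b"
  assumes "subspace U"
    and "\<And>j. j \<in> {1..k} \<Longrightarrow> h j + (if j < k then h (j + 1) else 0) \<in> U"
    and "j \<in> {1..k}"
  shows "h j \<in> U"
proof -
  have "j \<le> k" and j: "1 \<le> j" using assms(3) by auto
  from this(1) show ?thesis
  proof (induction j rule: inc_induct)
    case base
    then show ?case using assms(2)[of k] assms(3) by simp
  next
    case (step i)
    then have "h i + h (i + 1) \<in> U" "h (i + 1) \<in> U" using j assms(2)[of i] by auto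
    then show ?case using subspace_diff[OF assms(1)] by fastforce
  qed
qed

end

section \<open>Bilinear calculus in a Leibniz algebra\<close>

context leibniz_algebra
begin

lemma br_left [simp]:
  "br (u + v) w = br u w + br v w" "br (u - v) w = br u w - br v w" "br (- u) w = - br u w"
  "br (c *s u) w = c *s br u w" "br 0 w = 0" "br (\<Sum>i\<in>I. p i) w = (\<Sum>i\<in>I. br (p i) w)"
proof -
  interpret l: Vector_Spaces.linear scale scale "\<lambda>u. br u w" by (rule linear_left)
  show "br (u + v) w = br u w + br v w" "br (u - v) w = br u w - br v w" "br (- u) w = - br u w"
    "br (c *s u) w = c *s br u w" "br 0 w = 0" "br (\<Sum>i\<in>I. p i) w = (\<Sum>i\<in>I. br (p i) w)"
    by (rule l.add l.diff l.neg l.scale l.zero l.sum)+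
qed

lemma br_right [simp]:
  "br w (u + v) = br w u + br w v" "br w (u - v) = br w u - br w v" "br w (- u) = - br w u"
  "br w (c *s u) = c *s br w u" "br w 0 = 0" "br w (\<Sum>i\<in>I. p i) = (\<Sum>i\<in>I. br w (p i))"
proof -
  interpret l: Vector_Spaces.linear scale scale "br w" by (rule linear_right)
  show "br w (u + v) = br w u + br w v" "br w (u - v) = br w u - br w v" "br w (- u) = - br w u"
    "br w (c *s u) = c *s br w u" "br w 0 = 0" "br w (\<Sum>i\<in>I. p i) = (\<Sum>i\<in>I. br w (p i))"
    by (rule l.add l.diff l.neg l.scale l.zero l.sum)+
qed

lemma br_mem_if_on_generators:
  assumes U: "subspace U" and gen: "\<And>a b. a \<in> A \<Longrightarrow> b \<in> B \<Longrightarrow> br a b \<in> U"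
    and u: "u \<in> span A" and v: "v \<in> span B"
  shows "br u v \<in> U"
proof -
  have "br a v \<in> U" if "a \<in> A" for a
    using v
  proof (induction rule: span_induct_alt)
    case base then show ?case using U by (simp add: subspace_0)
  next
    case (step c b w)
    then show ?case using gen[OF that] by (auto intro: subspace_add[OF U] subspace_scale[OF U])
  qed
  note left = this
  show ?thesis using u
  proof (induction rule: span_induct_alt)
    case base then show ?case using U by (simp add: subspace_0)
  next
    case (step c b w)
    then show ?case using left by (auto intro: subspace_add[OF U] subspace_scale[OF U])
  qed
qed

lemma right_mult_derivation: "br (br u v) x = br (br u x) v + br u (br v x)"
  using leibniz_identity[of u v x] by simp

text \<open>Symmetrised products are right annihilators: expand \<open>[y,[u,v]]\<close> and \<open>[y,[v,u]]\<close>.\<close>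
lemma br_symmetrised: "br y (br u v + br v u) = 0"
  using leibniz_identity[of y u v] leibniz_identity[of y v u] by simp

lemma br_square: "br y (br u u) = 0"
  using leibniz_identity[of y u u] by simp

end

section \<open>One-dimensional extensions of the nilradical\<close>

text \<open>Independence of the basis is encoded by spanning together with the dimension, because
  spanning is all that then has to be re-established after a change of basis.\<close>
locale mu1_extension = leibniz_algebra scale br
  for scale :: "'a::field \<Rightarrow> 'b::ab_group_add \<Rightarrow> 'b" (infixr \<open>*s\<close> 75) and br +
  fixes m k :: nat and e f :: "nat \<Rightarrow> 'b" and x :: 'b and N :: "'b set"
  assumes m_ge: "4 \<le> m" and k_ge: "1 \<le> k"
    and table: "mu1_table m k e f"
    and span_ef: "span (e ` {1..m} \<union> f ` {1..2*k}) = N"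
    and complement: "\<exists>s. y - s *s x \<in> N"
    and dim_UNIV: "dim (UNIV :: 'b set) = m + 2 * k + 1"
    and ideal: "u \<in> N \<Longrightarrow> br u x \<in> N" "u \<in> N \<Longrightarrow> br x u \<in> N"
begin

text \<open>\<open>B\<close> is the right annihilator of \<open>N\<close> in \<open>N\<close>, and \<open>M\<close> the left one. The elements of \<open>K\<close> are those
  of \<open>N\<close> without an \<open>e\<^sub>1\<close>-component, and \<open>Q\<close> is the intersection of \<open>M\<close> and \<open>B\<close>.\<close>
abbreviation "V \<equiv> span (f ` {1..2*k})"
abbreviation "G \<equiv> span (f ` {k+1..2*k})"
abbreviation "E \<equiv> span (e ` {2..m})"
abbreviation "B \<equiv> span (e ` {2..m} \<union> f ` {k+1..2*k})"
abbreviation "K \<equiv> span (e ` {2..m} \<union> f ` {1..2*k})"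
abbreviation "M \<equiv> span (insert (e m) (f ` {1..2*k}))"
abbreviation "Q \<equiv> span (insert (e m) (f ` {k+1..2*k}))"

lemma subspace_N: "subspace N"
  using span_ef subspace_span by metis

lemma e_N: "i \<in> {1..m} \<Longrightarrow> e i \<in> N" and f_N: "i \<in> {1..2*k} \<Longrightarrow> f i \<in> N"
  unfolding span_ef[symmetric] by (auto intro: span_base)

lemma
  shows K_N: "K \<subseteq> N" and V_K: "V \<subseteq> K" and B_K: "B \<subseteq> K" and G_V: "G \<subseteq> V" and G_B: "G \<subseteq> B"
    and E_B: "E \<subseteq> B" and M_K: "M \<subseteq> K" and Q_M: "Q \<subseteq> M" and Q_B: "Q \<subseteq> B" and V_M: "V \<subseteq> M"
    and G_Q: "G \<subseteq> Q"
  unfolding span_ef[symmetric] using m_ge by (auto intro!: span_mono)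

lemma M_N: "M \<subseteq> N" and B_N: "B \<subseteq> N" and V_N: "V \<subseteq> N" and G_N: "G \<subseteq> N"
  using K_N V_K B_K M_K G_V by blast+

lemma br_ee: "i \<in> {1..m} \<Longrightarrow> j \<in> {1..m} \<Longrightarrow> br (e i) (e j) = (if j = 1 \<and> i < m then e (i + 1) else 0)"
  and br_ef: "i \<in> {1..m} \<Longrightarrow> j \<in> {1..2*k} \<Longrightarrow> br (e i) (f j) = (if i = 1 \<and> j \<le> k then f (k + j) else 0)"
  and br_fe: "i \<in> {1..2*k} \<Longrightarrow> j \<in> {1..m} \<Longrightarrow> br (f i) (e j) = 0"
  and br_ff: "i \<in> {1..2*k} \<Longrightarrow> j \<in> {1..2*k} \<Longrightarrow> br (f i) (f j) = 0"
  using table unfolding mu1_table_def by auto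

lemma br_M_N: "u \<in> M \<Longrightarrow> v \<in> N \<Longrightarrow> br u v = 0"
  using br_mem_if_on_generators[OF subspace_single_0, of "insert (e m) (f ` {1..2*k})" "e ` {1..m} \<union> f ` {1..2*k}" u v]
    br_ee br_ef br_fe br_ff m_ge unfolding span_ef by fastforce

lemma br_N_B: "u \<in> N \<Longrightarrow> v \<in> B \<Longrightarrow> br u v = 0"
  using br_mem_if_on_generators[OF subspace_single_0, of "e ` {1..m} \<union> f ` {1..2*k}" "e ` {2..m} \<union> f ` {k+1..2*k}" u v]
    br_ee br_ef br_fe br_ff m_ge unfolding span_ef by fastforce

lemma br_K_M: "u \<in> K \<Longrightarrow> v \<in> M \<Longrightarrow> br u v = 0"
  using br_mem_if_on_generators[OF subspace_single_0, of "e ` {2..m} \<union> f ` {1..2*k}" "insert (e m) (f ` {1..2*k})" u v]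
    br_ee br_ef br_fe br_ff m_ge by fastforce

lemma br_N_N: "u \<in> N \<Longrightarrow> v \<in> N \<Longrightarrow> br u v \<in> N"
  using br_mem_if_on_generators[OF subspace_N, of "e ` {1..m} \<union> f ` {1..2*k}" "e ` {1..m} \<union> f ` {1..2*k}" u v]
    br_ee br_ef br_fe br_ff m_ge e_N f_N subspace_0[OF subspace_N] unfolding span_ef by fastforce

lemma br_e1_M: "u \<in> M \<Longrightarrow> br (e 1) u \<in> G"
  using br_mem_if_on_generators[OF subspace_span[of "f ` {k+1..2*k}"], of "{e 1}" "insert (e m) (f ` {1..2*k})" "e 1" u]
    br_ee br_ef br_fe br_ff m_ge by (fastforce intro: span_base span_zero)

lemma br_N_e1: "u \<in> N \<Longrightarrow> br u (e 1) \<in> E"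
  using br_mem_if_on_generators[OF subspace_span[of "e ` {2..m}"], of "e ` {1..m} \<union> f ` {1..2*k}" "{e 1}" u "e 1"]
    br_ee br_ef br_fe br_ff m_ge unfolding span_ef by (fastforce intro: span_base span_zero)

text \<open>There are only \<open>m + 2k\<close> indices, and with \<open>x\<close> the vectors span a space of dimension \<open>m + 2k + 1\<close>.\<close>
lemma inj_and_independent:
  "inj_on (case_sum e f) ({1..m} <+> {1..2*k})"
  "independent (case_sum e f ` ({1..m} <+> {1..2*k}))"
proof -
  let ?I = "{1..m} <+> {1..2*k}" and ?p = "case_sum e f"
  have im: "?p ` ?I = e ` {1..m} \<union> f ` {1..2*k}"
    by (force simp: Plus_def image_Un image_image)
  have sp: "span (insert x (?p ` ?I)) = UNIV"
  proof -
    have "y \<in> span (insert x (?p ` ?I))" for y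
      using complement[of y] unfolding span_breakdown_eq im span_ef by blast
    then show ?thesis by blast
  qed
  have c: "card ?I = m + 2 * k" by (simp add: card_Plus)
  have le: "card (?p ` ?I) \<le> m + 2 * k" using card_image_le[of ?I ?p] c by simp
  have "m + 2 * k + 1 \<le> card (insert x (?p ` ?I))"
    using dim_le_card[of UNIV "insert x (?p ` ?I)"] sp dim_UNIV by simp
  moreover have "card (insert x (?p ` ?I)) \<le> card (?p ` ?I) + 1"
    by (simp add: card_insert_if)
  ultimately have "card (?p ` ?I) = card ?I" using le c by linarith
  then show "inj_on ?p ?I" by (intro eq_card_imp_inj_on) auto
  have "independent (insert x (?p ` ?I))"
    using sp le dim_UNIV by (intro independent_if_spanning_card_le_dim) (auto simp: card_insert_if)
  then show "independent (?p ` ?I)" by (rule independent_mono) auto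
qed

lemma coeffs_zero:
  assumes "(\<Sum>i=1..m. c i *s e i) + (\<Sum>j=1..2*k. d j *s f j) = 0"
  shows "i \<in> {1..m} \<Longrightarrow> c i = 0" "j \<in> {1..2*k} \<Longrightarrow> d j = 0"
proof -
  have s: "(\<Sum>z\<in>{1..m} <+> {1..2*k}. case_sum c d z *s case_sum e f z) = 0"
    using assms by (simp add: sum.Plus)
  show "c i = 0" if "i \<in> {1..m}"
    using independent_family_coeffs_zero[OF inj_and_independent(1) _ inj_and_independent(2) s, of "Inl i"] that
    by (simp add: InlI)
  show "d j = 0" if "j \<in> {1..2*k}"
    using independent_family_coeffs_zero[OF inj_and_independent(1) _ inj_and_independent(2) s, of "Inr j"] that
    by (simp add: InrI)
qed

lemma N_coeffs:
  assumes "u \<in> N"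
  obtains c d where "u = (\<Sum>i=1..m. c i *s e i) + (\<Sum>j=1..2*k. d j *s f j)"
  using assms in_span_image_iff[of "{1..m}" _ e] in_span_image_iff[of "{1..2*k}" _ f]
  unfolding span_ef[symmetric] span_Un by fastforce

lemma br_e1_expansion:
  "br (e 1) ((\<Sum>i=1..m. c i *s e i) + (\<Sum>j=1..2*k. d j *s f j))
     = c 1 *s e 2 + (\<Sum>j=1..k. d j *s f (k + j))"
proof -
  have "(\<Sum>i=1..m. c i *s br (e 1) (e i)) = (\<Sum>i=1..m. if i = 1 then c 1 *s e 2 else 0)"
    using m_ge by (intro sum.cong) (auto simp: br_ee numeral_2_eq_2)
  also have "\<dots> = c 1 *s e 2" using m_ge by simp
  finally have 1: "(\<Sum>i=1..m. c i *s br (e 1) (e i)) = c 1 *s e 2" .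
  have "(\<Sum>j=1..2*k. d j *s br (e 1) (f j)) = (\<Sum>j=1..2*k. if j \<le> k then d j *s f (k + j) else 0)"
    using m_ge by (intro sum.cong) (auto simp: br_ef)
  also have "\<dots> = (\<Sum>j=1..k. d j *s f (k + j))"
    by (intro sum.mono_neutral_cong_right) auto
  finally show ?thesis using 1 by simp
qed

lemma br_e1_right_expansion:
  "br ((\<Sum>i=1..m. c i *s e i) + (\<Sum>j=1..2*k. d j *s f j)) (e 1)
     = (\<Sum>i=1..m. (if i = 1 then 0 else c (i - 1)) *s e i)"
proof -
  have "(\<Sum>j=1..2*k. d j *s br (f j) (e 1)) = 0"
    using m_ge by (intro sum.neutral) (auto simp: br_fe)
  moreover have "(\<Sum>i=1..m. c i *s br (e i) (e 1)) = (\<Sum>i=1..m-1. c i *s e (i + 1))"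
    using m_ge by (intro sum.mono_neutral_cong_right) (auto simp: br_ee)
  moreover have "(\<Sum>i=1..m-1. c i *s e (i + 1)) = (\<Sum>i=2..m. c (i - 1) *s e i)"
    by (rule sum.reindex_bij_witness[of _ "\<lambda>i. i - 1" "\<lambda>i. i + 1"]) auto
  moreover have "(\<Sum>i=2..m. c (i - 1) *s e i) = (\<Sum>i=1..m. (if i = 1 then 0 else c (i - 1)) *s e i)"
    by (intro sum.mono_neutral_cong_left) auto
  ultimately show ?thesis by simp
qed

lemma B_if_br_e1_zero:
  assumes "u \<in> N" "br (e 1) u = 0"
  shows "u \<in> B"
proof -
  obtain c d where u: "u = (\<Sum>i=1..m. c i *s e i) + (\<Sum>j=1..2*k. d j *s f j)"
    using N_coeffs[OF assms(1)] .
  let ?c = "\<lambda>i. if i = 2 then c 1 else 0" and ?d = "\<lambda>j. if k < j then d (j - k) else 0"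
  have "(\<Sum>j=1..k. d j *s f (k + j)) = (\<Sum>j=k+1..2*k. d (j - k) *s f j)"
    by (rule sum.reindex_bij_witness[of _ "\<lambda>j. j - k" "\<lambda>j. k + j"]) auto
  also have "\<dots> = (\<Sum>j=1..2*k. ?d j *s f j)"
    by (intro sum.mono_neutral_cong_left) auto
  finally have 1: "(\<Sum>j=1..k. d j *s f (k + j)) = (\<Sum>j=1..2*k. ?d j *s f j)" .
  have "(\<Sum>i=1..m. ?c i *s e i) = (\<Sum>i=1..m. if i = 2 then c 1 *s e i else 0)"
    by (intro sum.cong) auto
  also have "\<dots> = c 1 *s e 2" using m_ge by simp
  finally have "(\<Sum>i=1..m. ?c i *s e i) + (\<Sum>j=1..2*k. ?d j *s f j) = 0"
    using assms(2) 1 unfolding u br_e1_expansion by simp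
  note z = coeffs_zero[OF this]
  have c1: "c 1 = 0" using z(1)[of 2] m_ge by simp
  have d: "d j = 0" if "j \<in> {1..k}" for j using z(2)[of "j + k"] that by simp
  have "c i *s e i \<in> B" if "i \<in> {1..m}" for i
    using that c1 by (cases "i = 1") (auto intro!: span_scale intro: span_base simp: span_zero)
  moreover have "d j *s f j \<in> B" if "j \<in> {1..2*k}" for j
    using that d[of j] by (cases "j \<le> k") (auto intro!: span_scale intro: span_base simp: span_zero)
  ultimately show ?thesis unfolding u by (intro span_add span_sum)
qed

lemma M_if_br_right_e1_zero:
  assumes "u \<in> N" "br u (e 1) = 0"
  shows "u \<in> M"
proof -
  obtain c d where u: "u = (\<Sum>i=1..m. c i *s e i) + (\<Sum>j=1..2*k. d j *s f j)"
    using N_coeffs[OF assms(1)] .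
  have "(\<Sum>i=1..m. (if i = 1 then 0 else c (i - 1)) *s e i) + (\<Sum>j=1..2*k. 0 *s f j) = 0"
    using assms(2) unfolding u br_e1_right_expansion by simp
  note z = coeffs_zero(1)[OF this]
  have c: "c i = 0" if "i \<in> {1..m}" "i \<noteq> m" for i
    using z[of "i + 1"] that by simp
  have "c i *s e i \<in> M" if "i \<in> {1..m}" for i
    using that c[of i] by (cases "i = m") (auto intro!: span_scale intro: span_base simp: span_zero)
  moreover have "d j *s f j \<in> M" if "j \<in> {1..2*k}" for j
    using that by (auto intro!: span_scale intro: span_base)
  ultimately show ?thesis unfolding u by (intro span_add span_sum)
qed

lemma E_Int_V:
  assumes "u \<in> E" "u \<in> V"
  shows "u = 0"
proof -
  obtain c where c: "u = (\<Sum>i=2..m. c i *s e i)" using assms(1) by (auto simp: in_span_image_iff)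
  obtain d where d: "u = (\<Sum>j=1..2*k. d j *s f j)" using assms(2) by (auto simp: in_span_image_iff)
  have "u = (\<Sum>i=1..m. (if 2 \<le> i then c i else 0) *s e i)"
    unfolding c by (intro sum.mono_neutral_cong_left) auto
  then have "(\<Sum>i=1..m. (if 2 \<le> i then c i else 0) *s e i) + (\<Sum>j=1..2*k. (- d j) *s f j) = 0"
    using d by (simp add: sum_negf)
  from coeffs_zero(2)[OF this] show ?thesis unfolding d by simp
qed

lemma f_nonzero: "j \<in> {1..2*k} \<Longrightarrow> f j \<noteq> 0"
  using coeffs_zero(2)[of "\<lambda>_. 0" "\<lambda>i. if i = j then 1 else 0" j] by (auto simp: if_distrib if_distribR cong: if_cong)

lemma M_Int_B:
  assumes "u \<in> M" "u \<in> B"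
  shows "u \<in> Q"
proof -
  obtain s where "u - s *s e m \<in> V" using assms(1) unfolding span_breakdown_eq by blast
  then have sV: "u - s *s e m \<in> V" .
  obtain p q where pq: "u = p + q" "p \<in> E" "q \<in> G"
    using assms(2) unfolding span_Un by blast
  have "p - s *s e m \<in> E"
    using pq m_ge by (intro span_diff span_scale) (auto intro: span_base)
  moreover have "p - s *s e m \<in> V"
    using span_diff[OF sV, of q] pq G_V by (auto simp: algebra_simps)
  ultimately have "p = s *s e m" using E_Int_V by force
  then have "u - s *s e m \<in> G" using pq by simp
  then show ?thesis unfolding span_breakdown_eq by blast
qed

subsection \<open>Consequences of the Leibniz identity\<close>

lemma e1_N: "e 1 \<in> N" using e_N m_ge by simp

text \<open>A derivation preserves the relation \<open>[v,e\<^sub>1] = 0\<close>, up to the term \<open>[v,[e\<^sub>1,x]] = 0\<close>, and this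
  relation characterises \<open>M\<close> inside \<open>N\<close>.\<close>
lemma br_V_x: "v \<in> V \<Longrightarrow> br v x \<in> M"
proof (rule M_if_br_right_e1_zero)
  assume v: "v \<in> V"
  then show "br v x \<in> N" using ideal V_N by blast
  have "br (br v x) (e 1) = br (br v (e 1)) x - br v (br (e 1) x)"
    using right_mult_derivation[of v "e 1" x] by simp
  also have "br v (e 1) = 0" using br_M_N v V_M e1_N by blast
  also have "br v (br (e 1) x) = 0" using br_M_N v V_M ideal(1)[OF e1_N] by blast
  finally show "br (br v x) (e 1) = 0" by simp
qed

text \<open>The \<open>e\<^sub>1\<close>-coefficient \<open>c\<close> of \<open>[x,e\<^sub>1]\<close> vanishes: expanding \<open>[x,[f\<^sub>1,e\<^sub>1]] = 0\<close> gives
  \<open>[[x,f\<^sub>1],e\<^sub>1] = c f\<^sub>k\<^sub>+\<^sub>1\<close>, whose left side lies in the span of \<open>e\<^sub>2, \<dots>, e\<^sub>m\<close>.\<close>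
lemma br_x_e1: "br x (e 1) \<in> K"
proof -
  obtain c d where u: "br x (e 1) = (\<Sum>i=1..m. c i *s e i) + (\<Sum>j=1..2*k. d j *s f j)"
    using N_coeffs[OF ideal(2)[OF e1_N]] .
  have f1: "f 1 \<in> N" using f_N k_ge by simp
  have "br (br x (f 1)) (e 1) = br (br x (e 1)) (f 1)"
    using leibniz_identity[of x "f 1" "e 1"] br_fe k_ge m_ge by simp
  also have "\<dots> = (\<Sum>i=1..m. c i *s br (e i) (f 1)) + (\<Sum>j=1..2*k. d j *s br (f j) (f 1))"
    unfolding u by simp
  also have "(\<Sum>j=1..2*k. d j *s br (f j) (f 1)) = 0"
    using k_ge by (intro sum.neutral) (simp add: br_ff)
  also have "(\<Sum>i=1..m. c i *s br (e i) (f 1)) = (\<Sum>i=1..m. if i = 1 then c 1 *s f (k + 1) else 0)"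
    using k_ge by (intro sum.cong) (auto simp: br_ef)
  also have "\<dots> = c 1 *s f (k + 1)" using m_ge by simp
  finally have eq: "br (br x (f 1)) (e 1) = c 1 *s f (k + 1)" by simp
  have "c 1 *s f (k + 1) \<in> V" using k_ge by (intro span_scale span_base) auto
  moreover have "c 1 *s f (k + 1) \<in> E"
    using br_N_e1[OF ideal(2)[OF f1]] unfolding eq .
  ultimately have "c 1 *s f (k + 1) = 0" using E_Int_V by blast
  then have c1: "c 1 = 0" using f_nonzero[of "k + 1"] k_ge by simp
  have "c i *s e i \<in> K" if "i \<in> {1..m}" for i
    using that c1 by (cases "i = 1") (auto intro!: span_scale intro: span_base simp: span_zero)
  moreover have "d j *s f j \<in> K" if "j \<in> {1..2*k}" for j
    using that by (auto intro!: span_scale intro: span_base)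
  ultimately show ?thesis unfolding u by (intro span_add span_sum)
qed

lemma br_x_V: "v \<in> V \<Longrightarrow> br x v \<in> M"
proof (rule M_if_br_right_e1_zero)
  assume v: "v \<in> V"
  then show "br x v \<in> N" using ideal V_N by blast
  have "br (br x v) (e 1) = br (br x (e 1)) v + br x (br v (e 1))"
    using right_mult_derivation[of x v "e 1"] by (simp add: add.commute leibniz_identity)
  also have "br v (e 1) = 0" using br_M_N v V_M e1_N by blast
  also have "br (br x (e 1)) v = 0" using br_K_M[OF br_x_e1] v V_M by blast
  finally show "br (br x v) (e 1) = 0" by simp
qed

lemma symmetrised_x_B: "u \<in> N \<Longrightarrow> br x u + br u x \<in> B"
  by (intro B_if_br_e1_zero br_symmetrised subspace_add[OF subspace_N] ideal)

lemma br_e1_x: "br (e 1) x \<in> K"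
  using span_diff[OF subsetD[OF B_K symmetrised_x_B[OF e1_N]] br_x_e1] by simp

text \<open>Each generator of \<open>B\<close> is a product of two elements \<open>u\<close>, \<open>v\<close> of \<open>N\<close>, and both terms of
  \<open>[[x,u],v] - [[x,v],u]\<close> vanish, or cancel each other for \<open>e\<^sub>2 = [e\<^sub>1,e\<^sub>1]\<close>.\<close>
lemma br_x_B: "u \<in> B \<Longrightarrow> br x u = 0"
proof -
  assume u: "u \<in> B"
  have e: "br x (e i) = 0" if "2 \<le> i" "i \<le> m" for i
    using that
  proof (induction i rule: dec_induct)
    case base
    have "e 2 = br (e 1) (e 1)" using br_ee[of 1 1] m_ge by (simp add: numeral_2_eq_2)
    then show ?case using leibniz_identity[of x "e 1" "e 1"] by simp
  next
    case (step i)
    have "e (Suc i) = br (e i) (e 1)" using br_ee[of i 1] step by simp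
    moreover have "br (br x (e 1)) (e i) = 0"
      using step by (intro br_N_B[OF ideal(2)[OF e1_N]] span_base) auto
    ultimately show ?case using leibniz_identity[of x "e i" "e 1"] step by simp
  qed
  have f: "br x (f (k + j)) = 0" if "j \<in> {1..k}" for j
  proof -
    have V: "f j \<in> V" using that by (auto intro: span_base)
    have "f (k + j) = br (e 1) (f j)" using br_ef[of 1 j] m_ge that by simp
    moreover have "br (br x (e 1)) (f j) = 0" using br_K_M[OF br_x_e1] V V_M by blast
    moreover have "br (br x (f j)) (e 1) = 0" using br_M_N[OF br_x_V[OF V] e1_N] .
    ultimately show ?thesis using leibniz_identity[of x "e 1" "f j"] by simp
  qed
  have f': "br x (f j) = 0" if "j \<in> {k+1..2*k}" for j
    using f[of "j - k"] that by (auto simp: le_diff_conv)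
  have "br x u \<in> {0}"
    using u by (intro br_mem_if_on_generators[OF subspace_single_0, of "{x}" _ x u])
      (auto simp: e f' span_base)
  then show ?thesis by simp
qed

lemma br_e1_V_x: "v \<in> V \<Longrightarrow> br (br (e 1) v) x = br (e 1) (br v x)"
  using right_mult_derivation[of "e 1" v x] br_K_M[OF br_e1_x] V_M by auto

subsection \<open>Changing the basis\<close>

lemma translate_x:
  assumes y: "y \<in> N"
  shows "mu1_extension scale br m k e f (x + y) N"
proof (unfold_locales, fact m_ge, fact k_ge, fact table, fact span_ef, goal_cases)
  case (1 u)
  obtain s where s: "u - s *s x \<in> N" using complement by blast
  have "u - s *s (x + y) = (u - s *s x) - s *s y" by (simp add: algebra_simps)
  then show ?case using subspace_diff[OF subspace_N s] subspace_scale[OF subspace_N y] by metis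
next
  case 2 show ?case by (rule dim_UNIV)
next
  case (3 u) then show ?case using subspace_add[OF subspace_N ideal(1) br_N_N] y by simp
next
  case (4 u) then show ?case using subspace_add[OF subspace_N ideal(2) br_N_N] y by simp
qed

text \<open>The first \<open>k\<close> of the \<open>f\<^sub>j\<close> may be moved within \<open>M\<close> as long as they still generate modulo \<open>Q\<close>;
  the last \<open>k\<close> are then determined by the table, and generate \<open>G\<close> because \<open>[e\<^sub>1,-]\<close> kills \<open>Q\<close>.\<close>
lemma change_f:
  assumes h: "\<And>j. j \<in> {1..k} \<Longrightarrow> h j \<in> M"
    and gen: "\<And>j. j \<in> {1..k} \<Longrightarrow> f j \<in> span (h ` {1..k} \<union> insert (e m) (f ` {k+1..2*k}))"
  defines "f' \<equiv> \<lambda>j. if j \<le> k then h j else br (e 1) (h (j - k))"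
  shows "mu1_extension scale br m k e f' x N"
proof (unfold_locales, fact m_ge, fact k_ge)
  have idx: "j - k \<in> {1..k}" if "j \<in> {k+1..2*k}" for j using that by auto
  have f'_M: "f' j \<in> M" if "j \<in> {1..2*k}" for j
    using that h[of j] subsetD[OF Q_M subsetD[OF G_Q br_e1_M[OF h[OF idx]]]] unfolding f'_def by auto
  have f'_B: "f' j \<in> B" if "j \<in> {k+1..2*k}" for j
    using that subsetD[OF G_B br_e1_M[OF h[OF idx]]] unfolding f'_def by auto
  show "mu1_table m k e f'"
    unfolding mu1_table_def
  proof (intro conjI ballI)
    fix i j assume ij: "i \<in> {1..m}" "j \<in> {1..2*k}"
    have "br (e i) (f' j) = 0" if "i \<noteq> 1"
      using that ij f'_M by (intro br_K_M) (auto intro: span_base)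
    moreover have "br (e 1) (f' j) = 0" if "\<not> j \<le> k"
      using that ij f'_B by (intro br_N_B e1_N) auto
    moreover have "br (e 1) (f' j) = f' (k + j)" if "j \<le> k"
      using that ij by (auto simp: f'_def)
    ultimately show "br (e i) (f' j) = (if i = 1 \<and> j \<le> k then f' (k + j) else 0)" by auto
  qed (use br_ee br_M_N[OF f'_M e_N] br_M_N[OF f'_M subsetD[OF M_N f'_M]] in auto)
  let ?S = "span (e ` {1..m} \<union> f' ` {1..2*k})"
  have "e ` {1..m} \<union> f' ` {1..2*k} \<subseteq> N" using e_N f'_M M_N by blast
  then have "?S \<subseteq> N" by (rule span_minimal[OF _ subspace_N])
  moreover have "N \<subseteq> ?S"
  proof -
    have f'_S: "f' j \<in> ?S" if "j \<in> {1..2*k}" for j using that by (auto intro: span_base)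
    have hS: "h j \<in> ?S" "br (e 1) (h j) \<in> ?S" if "j \<in> {1..k}" for j
      using that f'_S[of j] f'_S[of "k + j"] by (auto simp: f'_def)
    have e: "e i \<in> ?S" if "i \<in> {1..m}" for i using that by (auto intro: span_base)
    have f2: "f (k + j) \<in> ?S" if j: "j \<in> {1..k}" for j
    proof -
      have "f (k + j) = br (e 1) (f j)" using br_ef[of 1 j] m_ge j by simp
      moreover have "br (e 1) u \<in> ?S" if "u \<in> h ` {1..k} \<union> insert (e m) (f ` {k+1..2*k})" for u
        using that
      proof
        assume "u \<in> insert (e m) (f ` {k+1..2*k})"
        then have "br (e 1) u = 0" using Q_B by (intro br_N_B e1_N) (auto intro: span_base)
        then show ?thesis by (simp add: span_zero)
      qed (use hS(2) in auto)
      ultimately show ?thesis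
        using br_mem_if_on_generators[OF subspace_span _ span_base gen[OF j], of "{e 1}"] by auto
    qed
    have f3: "f j \<in> ?S" if "j \<in> {k+1..2*k}" for j using that f2[OF idx] by auto
    have "span (h ` {1..k} \<union> insert (e m) (f ` {k+1..2*k})) \<subseteq> ?S"
      using hS e f3 m_ge by (intro span_minimal[OF _ subspace_span]) auto
    then have "f j \<in> ?S" if "j \<in> {1..2*k}" for j
      using that gen[of j] f3[of j] by (cases "j \<le> k") auto
    then show ?thesis unfolding span_ef[symmetric] using e by (intro span_minimal[OF _ subspace_span]) auto
  qed
  ultimately show "?S = N" by blast
qed (fact complement dim_UNIV ideal)+

lemma ordered_basis_UNIV: "ordered_basis (map e [1..<m + 1] @ map f [1..<2*k + 1] @ [x]) UNIV"
proof (rule ordered_basis_if_spanning_length_dim)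
  let ?bs = "map e [1..<m + 1] @ map f [1..<2*k + 1] @ [x]"
  have set: "set ?bs = insert x (e ` {1..m} \<union> f ` {1..2*k})"
    by (auto simp: less_Suc_eq_le)
  have "y \<in> span (set ?bs)" for y
    using complement[of y] unfolding set span_breakdown_eq span_ef .
  then show "span (set ?bs) = UNIV" by blast
  show "length ?bs = dim (UNIV :: 'b set)" using dim_UNIV by simp
qed

subsection \<open>The projection onto the span of the first half of the f-part\<close>

lemma span_low_Int_complement:
  assumes "v \<in> span (f ` {1..k})" "v \<in> span (e ` {1..m} \<union> f ` {k+1..2*k})"
  shows "v = 0"
proof -
  obtain d where d: "v = (\<Sum>j=1..k. d j *s f j)" using assms(1) by (auto simp: in_span_image_iff)
  obtain p q where pq: "v = p + q" "p \<in> span (e ` {1..m})" "q \<in> span (f ` {k+1..2*k})"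
    using assms(2) unfolding span_Un by blast
  obtain c where c: "p = (\<Sum>i=1..m. c i *s e i)" using pq(2) by (auto simp: in_span_image_iff)
  obtain d' where d': "q = (\<Sum>j=k+1..2*k. d' j *s f j)" using pq(3) by (auto simp: in_span_image_iff)
  let ?d = "\<lambda>j. if j \<le> k then - d j else d' j"
  have "{1..2*k} = {1..k} \<union> {k+1..2*k}" by auto
  then have "(\<Sum>j=1..2*k. ?d j *s f j) = (\<Sum>j=1..k. ?d j *s f j) + (\<Sum>j=k+1..2*k. ?d j *s f j)"
    by (simp add: sum.union_disjoint)
  also have "(\<Sum>j=1..k. ?d j *s f j) = - v" unfolding d by (simp add: sum_negf)
  also have "(\<Sum>j=k+1..2*k. ?d j *s f j) = q" unfolding d' by (intro sum.cong) auto
  finally have "(\<Sum>i=1..m. c i *s e i) + (\<Sum>j=1..2*k. ?d j *s f j) = 0" using pq(1) c by simp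
  note z = coeffs_zero(2)[OF this]
  have "d j = 0" if "j \<in> {1..k}" for j using z[of j] that by simp
  then show ?thesis unfolding d by simp
qed

lemma projection_along_low:
  assumes "u \<in> span (f ` {1..k})" "w \<in> span (e ` {1..m} \<union> f ` {k+1..2*k})"
  shows "projection_along (span (f ` {1..k})) (span (e ` {1..m} \<union> f ` {k+1..2*k})) (u + w) = u"
  unfolding projection_along_def
proof (rule the_equality)
  fix u' assume u': "u' \<in> span (f ` {1..k}) \<and> u + w - u' \<in> span (e ` {1..m} \<union> f ` {k+1..2*k})"
  have "(u + w - u') - w \<in> span (e ` {1..m} \<union> f ` {k+1..2*k})"
    using u' assms(2) by (blast intro: span_diff)
  then have "u - u' \<in> span (e ` {1..m} \<union> f ` {k+1..2*k})" by simp
  then show "u' = u" using span_low_Int_complement[OF span_diff] u' assms(1) by force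
qed (use assms in auto)

lemma Q_complement: "Q \<subseteq> span (e ` {1..m} \<union> f ` {k+1..2*k})"
  using m_ge by (intro span_mono) auto

lemma br_low_x_decomp:
  assumes "v \<in> span (f ` {1..k})"
  obtains q r where "br v x = q + r" "q \<in> span (f ` {1..k})" "r \<in> Q"
proof -
  have "v \<in> V" using assms by (rule subsetD[OF span_mono, rotated]) auto
  then have "br v x \<in> M" by (rule br_V_x)
  also have "insert (e m) (f ` {1..2*k}) = f ` {1..k} \<union> insert (e m) (f ` {k+1..2*k})" by force
  finally show ?thesis using that unfolding span_Un by blast
qed

end

section \<open>Normalising the multiplication table\<close>

text \<open>The Jordan block is only known modulo \<open>Q\<close>, since the projection onto the span of
  \<open>f\<^sub>1, \<dots>, f\<^sub>k\<close> forgets the components of \<open>[f\<^sub>j,x]\<close> along \<open>e\<^sub>m\<close> and \<open>G\<close>.\<close>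
locale mu1_jordan_extension = mu1_extension +
  assumes jordan:
    "j \<in> {1..k} \<Longrightarrow> br (f j) x - (f j + (if j < k then f (j + 1) else 0)) \<in> span (insert (e m) (f ` {k+1..2*k}))"
begin

text \<open>Applying \<open>[e\<^sub>1,-]\<close>, which commutes with \<open>R\<^sub>x\<close> on \<open>V\<close> and kills \<open>Q\<close>, turns the Jordan block
  modulo \<open>Q\<close> into an exact one on \<open>G\<close>.\<close>
lemma br_f_upper_x:
  assumes j: "j \<in> {1..k}"
  shows "br (f (k + j)) x = f (k + j) + (if j < k then f (k + j + 1) else 0)"
proof -
  have f: "f (k + i) = br (e 1) (f i)" if "i \<in> {1..k}" for i
    using br_ef[of 1 i] m_ge that by simp
  have V: "f j \<in> V" using j by (auto intro: span_base)
  have "br (e 1) (br (f j) x - (f j + (if j < k then f (j + 1) else 0))) = 0"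
    using jordan[OF j] Q_B by (intro br_N_B e1_N) auto
  then have "br (e 1) (br (f j) x) = br (e 1) (f j + (if j < k then f (j + 1) else 0))" by simp
  then show ?thesis
    using f[of j] f[of "j + 1"] j br_e1_V_x[OF V] by (simp split: if_splits)
qed

text \<open>An \<open>x\<close>-component \<open>s x\<close> of \<open>[x,x]\<close> would give \<open>0 = [f\<^sub>2\<^sub>k,[x,x]] = s f\<^sub>2\<^sub>k\<close>.\<close>
lemma br_x_x_B: "br x x \<in> B"
proof -
  obtain s where s: "br x x - s *s x \<in> N" using complement by blast
  have V: "f (2*k) \<in> M" using k_ge by (auto intro: span_base)
  have "br (f (2*k)) (br x x - s *s x) = 0" using br_M_N[OF V s] .
  then have "s *s br (f (2*k)) x = 0" using br_square by simp
  moreover have "br (f (2*k)) x = f (2*k)" using br_f_upper_x[of k] k_ge by (simp add: mult_2)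
  ultimately have "s = 0" using f_nonzero[of "2*k"] k_ge by simp
  then show ?thesis using s by (intro B_if_br_e1_zero br_square) simp
qed

lemma br_G_x: "u \<in> G \<Longrightarrow> br u x \<in> G"
proof -
  assume u: "u \<in> G"
  have "br (f i) x \<in> G" if i: "i \<in> {k+1..2*k}" for i
  proof -
    obtain j where j: "j \<in> {1..k}" "i = k + j" using i that by (intro that[of "i - k"]) auto
    show ?thesis unfolding j(2) br_f_upper_x[OF j(1)] using j(1)
      by (intro span_add) (auto intro: span_base simp: span_zero)
  qed
  then show ?thesis using u
    by (intro br_mem_if_on_generators[OF subspace_span, of "f ` {k+1..2*k}" "{x}" _ u x]) (auto intro: span_base)
qed

lemma br_G_x_surj:
  assumes "u \<in> G"
  obtains t where "t \<in> G" "br t x = u"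
proof -
  interpret l: Vector_Spaces.linear scale scale "\<lambda>u. br u x" by (rule linear_left)
  let ?U = "(\<lambda>u. br u x) ` G"
  have U: "subspace ?U" by (rule l.subspace_image[OF subspace_span])
  have "f (k + j) \<in> ?U" if "j \<in> {1..k}" for j
  proof (rule mem_subspace_if_consecutive_sums[OF U _ that, where h = "\<lambda>j. f (k + j)"])
    fix j assume j: "j \<in> {1..k}"
    then have "br (f (k + j)) x \<in> ?U" by (intro imageI span_base) auto
    then show "f (k + j) + (if j < k then f (k + (j + 1)) else 0) \<in> ?U"
      unfolding br_f_upper_x[OF j] add.assoc .
  qed
  note shifted = this
  have "f j \<in> ?U" if "j \<in> {k+1..2*k}" for j
  proof -
    have "j - k \<in> {1..k}" "k + (j - k) = j" using that by auto
    then show ?thesis using shifted by metis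
  qed
  then have "f ` {k+1..2*k} \<subseteq> ?U" by blast
  then have "G \<subseteq> ?U" by (rule span_minimal[OF _ U])
  then show ?thesis using assms that by blast
qed

text \<open>\<open>R\<^sub>x - 1\<close> is nilpotent on \<open>G\<close>: it shifts the filtration by the tails of
  \<open>f\<^sub>k\<^sub>+\<^sub>1, \<dots>, f\<^sub>2\<^sub>k\<close>, whereas it is \<open>-1\<close> on the kernel of \<open>R\<^sub>x\<close>.\<close>
lemma br_G_x_inj:
  assumes u: "u \<in> G" and z: "br u x = 0"
  shows "u = 0"
proof -
  have shift: "br v x - v \<in> span (f ` {k+i+2..2*k})" if "v \<in> span (f ` {k+i+1..2*k})" for v i
    using that
  proof (induction rule: span_induct_alt)
    case base then show ?case by (simp add: span_zero)
  next
    case (step c b w)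
    then obtain l where l: "b = f l" "l \<in> {k+i+1..2*k}" by blast
    then have "br (f l) x = f l + (if l < 2*k then f (l + 1) else 0)"
      using br_f_upper_x[of "l - k"] by (auto simp: le_diff_conv)
    then have "br b x - b \<in> span (f ` {k+i+2..2*k})"
      using l by (auto intro: span_base simp: span_zero)
    then have "c *s (br b x - b) + (br w x - w) \<in> span (f ` {k+i+2..2*k})"
      using step by (intro span_add span_scale)
    then show ?case by (simp add: algebra_simps)
  qed
  have "u \<in> span (f ` {k+i+1..2*k})" for i
  proof (induction i)
    case 0 then show ?case using u by simp
  next
    case (Suc i)
    then show ?case using span_neg[OF shift[OF Suc]] z by simp
  qed
  from this[of k] show ?thesis by simp
qed

text \<open>The operator \<open>w \<mapsto> [w,x] - a [e\<^sub>1,w]\<close> is block triangular with respect to \<open>G\<close>, with the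
  invertible action of \<open>x\<close> as both diagonal blocks: the correction by \<open>a\<close> maps \<open>V\<close> into \<open>G\<close>
  and kills \<open>G\<close>.\<close>
lemma solve_mod_e_m:
  assumes "u \<in> V"
  obtains w c where "w \<in> V" "br w x - a *s br (e 1) w = u + c *s e m"
proof -
  let ?U = "{y. \<exists>w\<in>V. \<exists>c. br w x - a *s br (e 1) w = y + c *s e m}"
  have U: "subspace ?U"
  proof (rule subspaceI)
    show "0 \<in> ?U" by (auto intro!: bexI[of _ 0] exI[of _ 0] simp: span_zero)
  next
    fix y z assume "y \<in> ?U" "z \<in> ?U"
    then obtain v w c d where *: "v \<in> V" "w \<in> V" "br v x - a *s br (e 1) v = y + c *s e m"
      "br w x - a *s br (e 1) w = z + d *s e m" by blast
    have "br (v + w) x - a *s br (e 1) (v + w)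
        = (br v x - a *s br (e 1) v) + (br w x - a *s br (e 1) w)"
      by (simp add: algebra_simps)
    also have "\<dots> = (y + z) + (c + d) *s e m" unfolding * by (simp add: algebra_simps)
    finally show "y + z \<in> ?U" using *(1,2) span_add by blast
  next
    fix s y assume "y \<in> ?U"
    then obtain w c where *: "w \<in> V" "br w x - a *s br (e 1) w = y + c *s e m" by blast
    have "br (s *s w) x - a *s br (e 1) (s *s w) = s *s (br w x - a *s br (e 1) w)"
      by (simp add: algebra_simps)
    also have "\<dots> = s *s y + (s * c) *s e m" unfolding * by (simp add: algebra_simps)
    finally show "s *s y \<in> ?U" using *(1) span_scale by blast
  qed
  have G_U: "u \<in> ?U" if "u \<in> G" for u
  proof -
    obtain t where t: "t \<in> G" "br t x = u" using br_G_x_surj[OF \<open>u \<in> G\<close>] .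
    then have "br (e 1) t = 0" using br_N_B[OF e1_N] G_B by blast
    then show ?thesis using t G_V by (auto intro!: bexI[of _ t] exI[of _ 0])
  qed
  have "e m \<in> ?U" by (auto intro!: bexI[of _ 0] exI[of _ "-1"] simp: span_zero)
  then have "insert (e m) (f ` {k+1..2*k}) \<subseteq> ?U" using G_U span_base by blast
  then have Q_U: "Q \<subseteq> ?U" by (rule span_minimal[OF _ U])
  have low: "f j \<in> ?U" if "j \<in> {1..k}" for j
  proof (rule mem_subspace_if_consecutive_sums[OF U _ that])
    fix j assume j: "j \<in> {1..k}"
    then have V: "f j \<in> V" by (auto intro: span_base)
    then have 1: "br (f j) x - a *s br (e 1) (f j) \<in> ?U"
      by (intro CollectI bexI[of _ "f j"] exI[of _ 0]) auto
    have 2: "a *s br (e 1) (f j) \<in> ?U"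
      using V V_M by (intro subspace_scale[OF U] G_U br_e1_M) blast
    have 3: "br (f j) x - (f j + (if j < k then f (j + 1) else 0)) \<in> ?U"
      using jordan[OF j] Q_U by blast
    have "(br (f j) x - a *s br (e 1) (f j) + a *s br (e 1) (f j))
        - (br (f j) x - (f j + (if j < k then f (j + 1) else 0))) \<in> ?U"
      by (rule subspace_diff[OF U subspace_add[OF U 1 2] 3])
    then show "f j + (if j < k then f (j + 1) else 0) \<in> ?U"
      by (simp only: diff_add_cancel diff_diff_eq2 add_diff_cancel_left')
  qed
  have "f j \<in> ?U" if "j \<in> {1..2*k}" for j
    using that low[of j] G_U[OF span_base, of "f j"] by (cases "j \<le> k") auto
  then have "V \<subseteq> ?U" by (intro span_minimal[OF _ U]) blast
  then show ?thesis using assms that by blast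
qed

text \<open>Let \<open>[e\<^sub>1,x] = \<Sum>\<^sub>i a\<^sub>i e\<^sub>i + w\<^sub>1\<close> with \<open>i \<ge> 2\<close> and \<open>w\<^sub>1\<close> in \<open>V\<close>. Passing to \<open>e\<^sub>1 + w\<close> forces \<open>e\<^sub>2 + [e\<^sub>1,w]\<close>
  for \<open>e\<^sub>2\<close> and leaves the other \<open>e\<^sub>i\<close> unchanged, so the \<open>f\<close>-component left over is
  \<open>w\<^sub>1 + [w,x] - a\<^sub>2 [e\<^sub>1,w]\<close>; a multiple of \<open>e\<^sub>m\<close> is harmless.\<close>
lemma normalise_e1:
  obtains e' where "mu1_jordan_extension scale br m k e' f x N" "br (e' 1) x \<in> span (e' ` {2..m})"
proof -
  obtain p w1 where pw: "br (e 1) x = p + w1" "p \<in> E" "w1 \<in> V"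
    using br_e1_x unfolding span_Un by blast
  obtain a where a: "p = (\<Sum>i=2..m. a i *s e i)" using pw(2) by (auto simp: in_span_image_iff)
  obtain w c where w: "w \<in> V" and eq: "br w x - a 2 *s br (e 1) w = - w1 + c *s e m"
    using solve_mod_e_m[OF span_neg[OF pw(3)]] .
  define g where "g = br (e 1) w"
  define e' where "e' = (\<lambda>i. if i = 1 then e 1 + w else if i = 2 then e 2 + g else e i)"
  have wM: "w \<in> M" and g: "g \<in> G" using w V_M br_e1_M unfolding g_def by auto
  have e'_N: "e' i \<in> N" if "i \<in> {1..m}" for i
    using that e_N w V_N g G_N unfolding e'_def by (auto intro!: subspace_add[OF subspace_N])
  have e'_B: "e' i \<in> B" if "i \<in> {2..m}" for i
    using that subsetD[OF G_B g] unfolding e'_def by (auto intro!: span_add intro: span_base)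
  have ext: "mu1_extension scale br m k e' f x N"
  proof (unfold_locales, fact m_ge, fact k_ge)
    show "mu1_table m k e' f"
      unfolding mu1_table_def
    proof (intro conjI ballI)
      fix i j assume ij: "i \<in> {1..m}" "j \<in> {1..m}"
      have "br (e' i) (e' j) = 0" if "j \<noteq> 1"
        using that ij e'_N e'_B by (intro br_N_B) auto
      moreover have "br (e' i) (e' 1) = (if i < m then e' (i + 1) else 0)"
      proof -
        have gM: "g \<in> M" using g G_Q Q_M by blast
        have wN: "w \<in> N" using wM M_N by blast
        have *: "br w (e 1) = 0" "br w w = 0" "br g (e 1) = 0" "br g w = 0"
          using br_M_N[OF wM e1_N] br_M_N[OF wM wN] br_M_N[OF gM e1_N] br_M_N[OF gM wN] .
        have **: "br (e i) w = 0" if "i \<noteq> 1"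
          using that ij wM by (intro br_K_M) (auto intro: span_base)
        consider "i = 1" | "i = 2" | "i \<noteq> 1" "i \<noteq> 2" by blast
        then show ?thesis
        proof cases
          case 1
          have "e' 1 = e 1 + w" "e' (1 + 1) = e 2 + br (e 1) w" by (simp_all add: e'_def g_def)
          moreover have "br (e 1) (e 1) = e 2" using br_ee[of 1 1] m_ge by (simp add: numeral_2_eq_2)
          ultimately have "br (e' 1) (e' 1) = e' (1 + 1)"
            using *(1,2) by simp
          then show ?thesis using 1 m_ge by simp
        next
          case 2
          then show ?thesis
            using * ** br_ee[of 2 1] m_ge by (simp add: e'_def)
        next
          case 3
          then show ?thesis
            using ** br_ee[of i 1] ij m_ge by (simp add: e'_def)
        qed
      qed
      ultimately show "br (e' i) (e' j) = (if j = 1 \<and> i < m then e' (i + 1) else 0)"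
        by (cases "j = 1") auto
    next
      fix i j assume ij: "i \<in> {1..m}" "j \<in> {1..2*k}"
      have "f j \<in> N" "f j \<in> V" using ij f_N by (auto intro: span_base)
      then have "br w (f j) = 0" "br g (f j) = 0"
        using wM g G_Q Q_M by (auto intro!: br_M_N)
      then show "br (e' i) (f j) = (if i = 1 \<and> j \<le> k then f (k + j) else 0)"
        using br_ef[OF ij] m_ge ij by (auto simp: e'_def br_ef)
    next
      fix i j assume ij: "i \<in> {1..2*k}" "j \<in> {1..m}"
      then show "br (f i) (e' j) = 0"
        using e'_N V_M by (intro br_M_N) (auto intro: span_base)
    qed (use br_ff in auto)
    let ?S = "span (e' ` {1..m} \<union> f ` {1..2*k})"
    have "e' ` {1..m} \<union> f ` {1..2*k} \<subseteq> N" using e'_N f_N by blast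
    then have "?S \<subseteq> N" by (rule span_minimal[OF _ subspace_N])
    moreover have "N \<subseteq> ?S"
    proof -
      have V: "V \<subseteq> ?S" by (rule span_mono) auto
      have e': "e' i \<in> ?S" if "i \<in> {1..m}" for i using that by (auto intro: span_base)
      have e_eq: "e i = e' i - (if i = 1 then w else if i = 2 then g else 0)" for i
        by (simp add: e'_def)
      have diff: "(if i = 1 then w else if i = 2 then g else 0) \<in> ?S" for i :: nat
        using V w g G_V by (auto simp: span_zero)
      have "e i \<in> ?S" if "i \<in> {1..m}" for i
        by (subst e_eq) (rule span_diff[OF e'[OF that] diff])
      then show ?thesis unfolding span_ef[symmetric]
        by (intro span_minimal[OF _ subspace_span]) (auto intro: span_base)
    qed
    ultimately show "?S = N" by blast
  qed (fact complement dim_UNIV ideal)+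
  have e'm: "e' m = e m" using m_ge by (simp add: e'_def)
  have "mu1_jordan_extension scale br m k e' f x N"
    using jordan ext
    by (simp add: mu1_jordan_extension_def mu1_jordan_extension_axioms_def e'm)
  moreover have "br (e' 1) x \<in> span (e' ` {2..m})"
  proof -
    have "(\<Sum>i=2..m. a i *s e' i) = a 2 *s (e 2 + g) + (\<Sum>i=Suc 2..m. a i *s e i)"
      using m_ge by (subst sum.atLeast_Suc_atMost) (auto simp: e'_def intro!: sum.cong)
    also have "\<dots> = (\<Sum>i=2..m. a i *s e i) + a 2 *s g"
      using m_ge by (subst (2) sum.atLeast_Suc_atMost) (auto simp: algebra_simps)
    finally have "(\<Sum>i=2..m. a i *s e' i) = p + a 2 *s g" using a by simp
    moreover have "br (e' 1) x = p + w1 + br w x" using pw by (simp add: e'_def)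
    moreover have "br w x = - w1 + c *s e m + a 2 *s g" using eq by (simp add: g_def algebra_simps)
    ultimately have "br (e' 1) x = (\<Sum>i=2..m. a i *s e' i) + c *s e' m"
      by (simp add: e'm)
    also have "\<dots> \<in> span (e' ` {2..m})"
      using m_ge by (intro span_add span_sum span_scale span_base) auto
    finally show ?thesis .
  qed
  ultimately show ?thesis by (rule that)
qed

lemma translate_x_jordan:
  assumes y: "y \<in> N"
  shows "mu1_jordan_extension scale br m k e f (x + y) N"
proof -
  have fy: "br (f j) y = 0" if "j \<in> {1..k}" for j
    using that by (intro br_M_N y span_base) auto
  show ?thesis
  proof (rule mu1_jordan_extension.intro[OF translate_x[OF y]], rule mu1_jordan_extension_axioms.intro)
    fix j assume j: "j \<in> {1..k}"
    show "br (f j) (x + y) - (f j + (if j < k then f (j + 1) else 0)) \<in> Q"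
      unfolding br_right fy[OF j] add_0_right by (rule jordan[OF j])
  qed
qed

text \<open>Write \<open>[x,e\<^sub>1] = p + u\<close> with \<open>p\<close> in \<open>E\<close> and \<open>u\<close> in \<open>G\<close>. The shift \<open>[-,e\<^sub>1]\<close> reaches all of \<open>E\<close>, so \<open>p\<close>
  can be cancelled by translating \<open>x\<close>. For the new \<open>x\<close> the identity for \<open>[x,[e\<^sub>1,x]] = 0\<close> reads
  \<open>[u,x] = [[x,x],e\<^sub>1]\<close>, an equation between \<open>G\<close> and \<open>E\<close>; hence both sides vanish.\<close>
lemma normalise_x:
  assumes e1: "br (e 1) x \<in> E"
  obtains x' \<eta> where "mu1_jordan_extension scale br m k e f x' N" "br (e 1) x' \<in> E"
    "br x' (e 1) = 0" "br x' x' = \<eta> *s e m"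
proof -
  have "br x (e 1) \<in> B"
    using span_diff[OF symmetrised_x_B[OF e1_N] subsetD[OF E_B e1]] by simp
  then obtain p u where pu: "br x (e 1) = p + u" "p \<in> E" "u \<in> G"
    unfolding span_Un by blast
  obtain b where b: "p = (\<Sum>i=2..m. b i *s e i)" using pu(2) by (auto simp: in_span_image_iff)
  define y where "y = - (\<Sum>i=1..m-1. b (i + 1) *s e i)"
  have y_span: "y \<in> span (e ` {1..m})"
    unfolding y_def by (intro span_neg span_sum span_scale span_base) auto
  have "span (e ` {1..m}) \<subseteq> N" using e_N by (intro span_minimal subspace_N) auto
  then have yN: "y \<in> N" using y_span by blast
  have "br (e i) (e 1) = e (i + 1)" if "i \<in> {1..m-1}" for i
  proof -
    have "i \<in> {1..m}" "i < m" using that m_ge unfolding atLeastAtMost_iff by linarith+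
    then show ?thesis using br_ee[of i 1] m_ge by simp
  qed
  then have "br y (e 1) = - (\<Sum>i=1..m-1. b (i + 1) *s e (i + 1))"
    unfolding y_def br_left by (intro arg_cong[of _ _ uminus] sum.cong) simp_all
  also have "(\<Sum>i=1..m-1. b (i + 1) *s e (i + 1)) = p"
    unfolding b by (rule sum.reindex_bij_witness[of _ "\<lambda>i. i - 1" "\<lambda>i. i + 1"]) auto
  finally have ye1: "br y (e 1) = - p" .
  have e1y: "br (e 1) y \<in> E"
  proof -
    have "br u v \<in> E" if uv: "u \<in> {e 1}" "v \<in> e ` {1..m}" for u v
    proof -
      obtain i where i: "v = e i" "i \<in> {1..m}" using uv(2) by blast
      show ?thesis
        using uv(1) i br_N_e1[OF e1_N] br_ee[of 1 i] m_ge by (cases "i = 1") (auto simp: span_zero)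
    qed
    note gen = this
    show ?thesis
    proof (rule br_mem_if_on_generators[where A = "{e 1}" and B = "e ` {1..m}"])
      show "subspace E" by (rule subspace_span)
      show "e 1 \<in> span {e 1}" by (rule span_base) simp
      show "y \<in> span (e ` {1..m})" by (rule y_span)
    qed (rule gen)
  qed
  \<comment> \<open>\<open>y\<close> is the preimage of \<open>-p\<close> under the shift \<open>[-,e\<^sub>1]\<close>.\<close>
  define x1 where "x1 = x + y"
  interpret j1: mu1_jordan_extension scale br m k e f x1 N
    unfolding x1_def by (rule translate_x_jordan[OF yN])
  have x1e1: "br x1 (e 1) = u" using pu(1) ye1 by (simp add: x1_def)
  have e1x1: "br (e 1) x1 \<in> E" unfolding x1_def br_right by (rule span_add[OF e1 e1y])
  have "br x1 (br (e 1) x1) = 0" using j1.br_x_B e1x1 E_B by blast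
  then have eq: "br u x1 = br (br x1 x1) (e 1)"
    using leibniz_identity[of x1 "e 1" x1] x1e1 by simp
  have "br (br x1 x1) (e 1) \<in> E" using j1.br_x_x_B B_N br_N_e1 by blast
  moreover have "br u x1 \<in> V" using j1.br_G_x[OF pu(3)] G_V by blast
  ultimately have ux: "br u x1 = 0" using E_Int_V[of "br u x1"] eq by simp
  then have xxe1: "br (br x1 x1) (e 1) = 0" using eq by simp
  have u0: "u = 0" by (rule j1.br_G_x_inj[OF pu(3) ux])
  have "br x1 x1 \<in> Q"
    using j1.br_x_x_B B_N xxe1 by (intro M_Int_B M_if_br_right_e1_zero) auto
  then obtain \<eta> where q: "br x1 x1 - \<eta> *s e m \<in> G" unfolding span_breakdown_eq by blast
  obtain t where t: "t \<in> G" "br t x1 = - (br x1 x1 - \<eta> *s e m)"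
    using j1.br_G_x_surj[OF span_neg[OF q]] .
  \<comment> \<open>Adding \<open>t\<close> from \<open>G\<close> changes \<open>[x,x]\<close> by \<open>[t,x]\<close> only.\<close>
  have tB: "t \<in> B" "t \<in> M" "t \<in> N" using t G_B G_V V_M M_N by auto
  have "br x1 t = 0" "br (e 1) t = 0" "br t t = 0" "br t (e 1) = 0"
    using j1.br_x_B[OF tB(1)] br_N_B[OF e1_N tB(1)] br_N_B[OF tB(3,1)] br_M_N[OF tB(2) e1_N] by auto
  then have "br (e 1) (x1 + t) \<in> E" "br (x1 + t) (e 1) = 0" "br (x1 + t) (x1 + t) = \<eta> *s e m"
    using e1x1 x1e1 u0 t(2) by simp_all
  then show ?thesis using that j1.translate_x_jordan[OF tB(3)] by blast
qed

text \<open>As \<open>L\<^sub>x\<close> kills \<open>Q\<close>, the vectors \<open>[x,f\<^sub>j]\<close> satisfy \<open>L\<^sub>x R\<^sub>x f\<^sub>j = L\<^sub>x f\<^sub>j + L\<^sub>x f\<^sub>j\<^sub>+\<^sub>1\<close> exactly. The Leibniz identity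
  identifies the left side with \<open>R\<^sub>x L\<^sub>x f\<^sub>j\<close>, as \<open>[[x,x],f\<^sub>j] = 0\<close>; it is also \<open>-L\<^sub>x L\<^sub>x f\<^sub>j\<close>, because \<open>L\<^sub>x f\<^sub>j + R\<^sub>x f\<^sub>j\<close>
  lies in \<open>B\<close>.\<close>
lemma extension_table_if_normalised:
  assumes e1x: "br (e 1) x \<in> E" and xe1: "br x (e 1) = 0" and xx: "br x x = \<eta> *s e m"
  obtains a f' where "mu1_extension scale br m k e f' x N" "extension_table m k a e f' x"
proof -
  define f' where "f' = (\<lambda>j. if j \<le> k then br x (f j) else br (e 1) (br x (f (j - k))))"
  have fV: "f j \<in> V" if "j \<in> {1..2*k}" for j using that by (auto intro: span_base)
  have hM: "br x (f j) \<in> M" if "j \<in> {1..k}" for j using that by (intro br_x_V fV) auto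
  have ext: "mu1_extension scale br m k e f' x N"
    unfolding f'_def
  proof (rule change_f[where h = "\<lambda>j. br x (f j)", OF hM])
    let ?S = "span ((\<lambda>j. br x (f j)) ` {1..k} \<union> insert (e m) (f ` {k+1..2*k}))"
    have Q: "Q \<subseteq> ?S" by (rule span_mono) auto
    \<comment> \<open>Modulo \<open>Q\<close>, \<open>[x,f\<^sub>j]\<close> is \<open>-f\<^sub>j - f\<^sub>j\<^sub>+\<^sub>1\<close>, so back substitution recovers every \<open>f\<^sub>j\<close>.\<close>
    have cancel: "(u + v) - (v - w) - u = w" for u v w :: 'b
      by (simp add: algebra_simps)
    show "f j \<in> ?S" if "j \<in> {1..k}" for j
    proof (rule mem_subspace_if_consecutive_sums[OF subspace_span _ that])
      fix j assume j: "j \<in> {1..k}"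
      then have V: "f j \<in> V" by (intro fV) auto
      have 1: "br x (f j) + br (f j) x \<in> Q"
        using V br_V_x[OF V] hM[OF j] V_N by (intro M_Int_B symmetrised_x_B span_add) auto
      have "br x (f j) \<in> ?S" using j by (intro span_base) auto
      from span_diff[OF span_diff[OF subsetD[OF Q 1] subsetD[OF Q jordan[OF j]]] this]
      show "f j + (if j < k then f (j + 1) else 0) \<in> ?S"
        unfolding cancel .
    qed
  qed
  interpret c: mu1_extension scale br m k e f' x N by (rule ext)
  have xf: "br x (f' j) = - f' j - (if j < k then f' (j + 1) else 0)"
    and fx: "br (f' j) x = f' j + (if j < k then f' (j + 1) else 0)" if j: "j \<in> {1..k}" for j
  proof -
    have V: "f j \<in> V" using j by (intro fV) auto
    have "br x (br (f j) x - (f j + (if j < k then f (j + 1) else 0))) = 0"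
      using jordan[OF j] Q_B by (intro br_x_B) auto
    then have 1: "br x (br (f j) x) = f' j + (if j < k then f' (j + 1) else 0)"
      using j by (auto simp: f'_def)
    have "br x (br x (f j) + br (f j) x) = 0"
      using V V_N by (intro br_x_B symmetrised_x_B) auto
    then have "br x (f' j) = - br x (br (f j) x)"
      using j by (simp add: f'_def eq_neg_iff_add_eq_0)
    then show "br x (f' j) = - f' j - (if j < k then f' (j + 1) else 0)" using 1 by simp
    have "br (br x x) (f j) = 0"
      unfolding xx using V V_N m_ge by (intro br_M_N span_scale) (auto intro: span_base)
    then show "br (f' j) x = f' j + (if j < k then f' (j + 1) else 0)"
      using leibniz_identity[of x "f j" x] 1 j by (simp add: f'_def)
  qed
  have fx2: "br (f' (k + j)) x = f' (k + j) + (if j < k then f' (k + j + 1) else 0)"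
    if j: "j \<in> {1..k}" for j
  proof -
    have f: "f' (k + i) = br (e 1) (f' i)" if "i \<in> {1..k}" for i
      using c.br_ef[of 1 i] m_ge that by simp
    have "f' j \<in> c.V" using j by (auto intro: span_base)
    then show ?thesis using c.br_e1_V_x fx[OF j] f[of j] f[of "j + 1"] j by (simp split: if_splits)
  qed
  obtain b where b: "br (e 1) x = (\<Sum>i=2..m. b i *s e i)" using e1x by (auto simp: in_span_image_iff)
  \<comment> \<open>The coefficient sequence stores \<open>[x,x]\<close> at index \<open>m + 1\<close>, beyond those used by \<open>[e\<^sub>1,x]\<close>.\<close>
  define a where "a = b(m + 1 := \<eta>)"
  have ex: "br (e i) x = (\<Sum>j=i+1..m. a (j - i + 1) *s e j)" if "1 \<le> i" "i \<le> m" for i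
    using that
  proof (induction i rule: dec_induct)
    case base
    show ?case unfolding b by (rule sum.cong) (auto simp: a_def)
  next
    case (step i)
    have ei: "e (Suc i) = br (e i) (e 1)" using br_ee[of i 1] step by simp
    have "br (e i) (br (e 1) x) = 0" using e1x E_B step by (intro br_N_B e_N) auto
    then have "br (e (Suc i)) x = br (br (e i) x) (e 1)"
      unfolding ei using right_mult_derivation[of "e i" "e 1" x] by simp
    also have "\<dots> = (\<Sum>j=i+1..m. a (j - i + 1) *s br (e j) (e 1))"
      using step by simp
    also have "\<dots> = (\<Sum>j=i+1..m-1. a (j - i + 1) *s e (j + 1))"
      using step by (intro sum.mono_neutral_cong_right) (auto simp: br_ee)
    also have "\<dots> = (\<Sum>j=Suc i+1..m. a (j - Suc i + 1) *s e j)"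
      by (rule sum.reindex_bij_witness[of _ "\<lambda>j. j - 1" "\<lambda>j. j + 1"]) auto
    finally show ?case .
  qed
  have xe: "br x (e i) = 0" if "i \<in> {1..m}" for i
    using that xe1 by (cases "i = 1") (auto intro!: br_x_B intro: span_base)
  have xf2: "br x (f' i) = 0" if "i \<in> {k+1..2*k}" for i
    using that by (intro c.br_x_B) (auto intro: span_base)
  have "extension_table m k a e f' x"
    unfolding extension_table_def
  proof (intro conjI ballI)
    fix i assume i: "i \<in> {k+1..2*k-1}"
    have "i - k \<in> {1..k}" "i - k < k" "k + (i - k) = i" using i k_ge unfolding atLeastAtMost_iff by linarith+
    then show "br (f' i) x = f' i + f' (i + 1)" using fx2[of "i - k"] by simp
  next
    show "br (f' (2*k)) x = f' (2*k)" using fx2[of k] k_ge by (simp add: mult_2)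
  qed (use c.table ex fx xf xe xf2 xx k_ge in \<open>auto simp: a_def\<close>)
  then show ?thesis using that ext by blast
qed

end

text \<open>By \<open>br_low_x_decomp\<close> the projection of \<open>[h\<^sub>j,x]\<close> determines \<open>[h\<^sub>j,x]\<close> modulo \<open>Q\<close>, and \<open>Q\<close> is unchanged
  by passing to the basis built from \<open>h\<close>.\<close>
lemma (in mu1_extension) jordan_extension_if_projection:
  assumes h: "\<And>j. j \<in> {1..k} \<Longrightarrow> h j \<in> span (f ` {1..k})"
    and gen: "f ` {1..k} \<subseteq> span (h ` {1..k})"
    and proj: "\<And>j. j \<in> {1..k} \<Longrightarrow>
      projection_along (span (f ` {1..k})) (span (e ` {1..m} \<union> f ` {k+1..2*k})) (br (h j) x)
        = h j + (if j < k then h (j + 1) else 0)"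
  defines "f' \<equiv> \<lambda>j. if j \<le> k then h j else br (e 1) (h (j - k))"
  shows "mu1_jordan_extension scale br m k e f' x N"
proof -
  have low_M: "span (f ` {1..k}) \<subseteq> M" by (rule span_mono) auto
  have hspan: "span (h ` {1..k}) \<subseteq> span (h ` {1..k} \<union> insert (e m) (f ` {k+1..2*k}))"
    by (rule span_mono) auto
  have ext: "mu1_extension scale br m k e f' x N"
    unfolding f'_def
  proof (rule change_f)
    show "h j \<in> M" if "j \<in> {1..k}" for j using h[OF that] low_M by blast
    show "f j \<in> span (h ` {1..k} \<union> insert (e m) (f ` {k+1..2*k}))" if "j \<in> {1..k}" for j
      using that gen hspan by blast
  qed
  let ?Q' = "span (insert (e m) (f' ` {k+1..2*k}))"
  have Q_Q': "Q \<subseteq> ?Q'"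
  proof (rule span_minimal[OF _ subspace_span])
    have br_h: "br (e 1) (h j) \<in> ?Q'" if "j \<in> {1..k}" for j
    proof -
      have "f' (k + j) \<in> ?Q'" using that by (intro span_base) auto
      then show ?thesis using that by (simp add: f'_def)
    qed
    have up: "br (e 1) u \<in> ?Q'" if "u \<in> span (h ` {1..k})" for u
    proof (rule br_mem_if_on_generators[where A = "{e 1}" and B = "h ` {1..k}"])
      show "subspace ?Q'" by (rule subspace_span)
      show "e 1 \<in> span {e 1}" by (rule span_base) simp
      show "u \<in> span (h ` {1..k})" by fact
    qed (use br_h in blast)
    have "f j \<in> ?Q'" if "j \<in> {k+1..2*k}" for j
    proof -
      have j: "j - k \<in> {1..k}" "k + (j - k) = j" using that by auto
      have "f (j - k) \<in> span (h ` {1..k})" using gen j(1) by blast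
      moreover have "f j = br (e 1) (f (j - k))" using br_ef[of 1 "j - k"] m_ge j by simp
      ultimately show ?thesis using up by metis
    qed
    then show "insert (e m) (f ` {k+1..2*k}) \<subseteq> ?Q'" by (auto intro: span_base)
  qed
  have "br (f' j) x - (f' j + (if j < k then f' (j + 1) else 0)) \<in> ?Q'" if j: "j \<in> {1..k}" for j
  proof -
    obtain q r where qr: "br (h j) x = q + r" "q \<in> span (f ` {1..k})" "r \<in> Q"
      using br_low_x_decomp[OF h[OF j]] .
    have "q = h j + (if j < k then h (j + 1) else 0)"
      using proj[OF j] projection_along_low[OF qr(2) subsetD[OF Q_complement qr(3)]] qr(1) by simp
    then have "br (f' j) x - (f' j + (if j < k then f' (j + 1) else 0)) = r"
      using qr(1) j by (auto simp: f'_def)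
    then show ?thesis using subsetD[OF Q_Q' qr(3)] by metis
  qed
  then show ?thesis
    by (intro mu1_jordan_extension.intro mu1_jordan_extension_axioms.intro ext)
qed

theorem theorem4p4:
  fixes scale :: "complex \<Rightarrow> 'v::ab_group_add \<Rightarrow> 'v"
    and br :: "'v \<Rightarrow> 'v \<Rightarrow> 'v"
    and n k :: nat
    and N \<F> \<W> :: "'v set"
    and e f :: "nat \<Rightarrow> 'v"
    and x :: 'v
    and eigval :: complex
    and g :: "'v list"
  assumes "k \<ge> 1" and "n - 2 * k \<ge> 4"
    and "leibniz_algebra scale br"
    and "leibniz_algebra.solvable scale br"
    and "vector_space.dim scale (UNIV :: 'v set) = n + 1"
    and "leibniz_algebra.is_nilradical scale br N"
    and "vector_space.ordered_basis scale (map e [1..<n - 2*k + 1] @ map f [1..<2*k + 1]) N"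
    and "leibniz_algebra.mu1_table br (n - 2*k) k e f"
    and "vector_space.complementary scale (module.span scale {x}) N"
    and "\<F> = module.span scale (f ` {1..k})"
    and "\<W> = module.span scale (e ` {1..n - 2*k} \<union> f ` {k+1..2*k})"
    and "vector_space.ordered_basis scale g \<F>"
    and "vector_space.matrix_in_basis scale
           (vector_space.projection_along \<F> \<W> \<circ> leibniz_algebra.right_mult br x)
           g (jordan_block k eigval)"
    and "eigval \<noteq> 0"
  shows "\<exists>(a :: nat \<Rightarrow> complex) e' f' x'.
           vector_space.ordered_basis scale
             (map e' [1..<n - 2*k + 1] @ map f' [1..<2*k + 1] @ [x']) UNIV \<and>
           leibniz_algebra.extension_table scale br (n - 2*k) k a e' f' x'"
proof -
  interpret leibniz_algebra scale br by fact
  define m where "m = n - 2 * k"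
  have n: "n = m + 2 * k" using assms(2) by (simp add: m_def)
  define x0 where "x0 = scale (1 / eigval) x"
  have N_eq: "span (e ` {1..m} \<union> f ` {1..2*k}) = N"
  proof -
    have "set (map e [1..<m + 1] @ map f [1..<2*k + 1]) = e ` {1..m} \<union> f ` {1..2*k}"
      by (auto simp: less_Suc_eq_le)
    then show ?thesis using assms(7) unfolding ordered_basis_def m_def[symmetric] by simp
  qed
  have ideal: "leibniz_ideal N" using assms(6) by (simp add: is_nilradical_def)
  then have N: "subspace N" by (simp add: leibniz_ideal_def)
  have dimN: "dim UNIV = m + 2 * k + 1" using assms(5) n by simp
  interpret r: mu1_extension scale br m k e f x0 N
  proof (unfold_locales)
    show "4 \<le> m" "1 \<le> k" "mu1_table m k e f" using assms(1,2,8) by (simp_all add: m_def)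
    show "\<exists>s. y - scale s x0 \<in> N" for y
    proof -
      obtain u w where u: "u \<in> span {x}" and w: "w \<in> N" "y = u + w"
        using assms(9) unfolding complementary_def by blast
      obtain s where "u = scale s x" using u by (auto simp: span_singleton)
      then have "y - scale (s * eigval) x0 = w" using w assms(14) by (simp add: x0_def)
      then show ?thesis using w by metis
    qed
    show "br u x0 \<in> N" "br x0 u \<in> N" if "u \<in> N" for u
      using ideal that subspace_scale[OF N] by (auto simp: x0_def leibniz_ideal_def)
  qed (fact N_eq dimN)+
  have F: "\<F> = span (f ` {1..k})" and W: "\<W> = span (e ` {1..m} \<union> f ` {k+1..2*k})"
    using assms(10,11) by (simp_all add: m_def)
  have mat: "jordan_block k eigval \<in> carrier_mat (length g) (length g)"
    "\<forall>l<length g. projection_along \<F> \<W> (br (g ! l) x)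
      = (\<Sum>i<length g. scale (jordan_block k eigval $$ (i, l)) (g ! i))"
    using assms(13) unfolding matrix_in_basis_def right_mult_def o_def by blast+
  have g: "length g = k" using carrier_matD(1)[OF mat(1)] by simp
  have gF: "span (set g) = \<F>" using assms(12) unfolding ordered_basis_def by blast
  have T: "projection_along \<F> \<W> (br (g ! l) x)
      = scale eigval (g ! l) + (if 0 < l then g ! (l - 1) else 0)" if l: "l < k" for l
  proof -
    have "(\<Sum>i<k. scale (jordan_block k eigval $$ (i, l)) (g ! i))
      = (\<Sum>i<k. (if i = l then scale eigval (g ! l) else 0)
             + (if i = l - 1 then (if 0 < l then g ! (l - 1) else 0) else 0))"
      using l by (intro sum.cong) auto
    also have "\<dots> = scale eigval (g ! l) + (if 0 < l then g ! (l - 1) else 0)"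
      using l by (subst sum.distrib) auto
    finally show ?thesis using mat(2) l unfolding g by simp
  qed
  have g_low: "g ! l \<in> span (f ` {1..k})" if "l < k" for l
    using that g gF F span_base[of "g ! l" "set g"] by simp
  \<comment> \<open>The Jordan block shifts \<open>g\<close> downwards, whence the reversal. Dividing \<open>x\<close> by the eigenvalue
    leaves off-diagonal entries \<open>1 / eigval\<close>, which the powers absorb.\<close>
  define h where "h = (\<lambda>i. scale (1 / eigval ^ i) (g ! (k - i)))"
  define f0 where "f0 = (\<lambda>j. if j \<le> k then h j else br (e 1) (h (j - k)))"
  have "mu1_jordan_extension scale br m k e f0 x0 N"
    unfolding f0_def
  proof (rule r.jordan_extension_if_projection)
    show "h j \<in> span (f ` {1..k})" if "j \<in> {1..k}" for j
      using that g_low[of "k - j"] by (auto simp: h_def intro: span_scale)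
    show "f ` {1..k} \<subseteq> span (h ` {1..k})"
    proof -
      have "g ! l \<in> span (h ` {1..k})" if l: "l < k" for l
      proof -
        have "h (k - l) \<in> span (h ` {1..k})" using l by (intro span_base) auto
        moreover have "g ! l = scale (eigval ^ (k - l)) (h (k - l))"
          using l assms(14) by (simp add: h_def)
        ultimately show ?thesis using span_scale by metis
      qed
      then have "set g \<subseteq> span (h ` {1..k})" using g by (auto simp: in_set_conv_nth)
      then have "\<F> \<subseteq> span (h ` {1..k})" using gF span_minimal[OF _ subspace_span] by blast
      then show ?thesis using F span_superset by blast
    qed
    show "projection_along (span (f ` {1..k})) (span (e ` {1..m} \<union> f ` {k+1..2*k})) (br (h j) x0)
        = h j + (if j < k then h (j + 1) else 0)" if j: "j \<in> {1..k}" for j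
    proof -
      let ?l = "k - j" and ?c = "1 / eigval ^ j"
      have l: "?l < k" using j by auto
      obtain q r where qr: "br (g ! ?l) x0 = q + r" "q \<in> span (f ` {1..k})"
        "r \<in> span (insert (e m) (f ` {k+1..2*k}))"
        using r.br_low_x_decomp[OF g_low[OF l]] .
      have rW: "r \<in> \<W>" using qr(3) r.Q_complement W by blast
      have proj: "projection_along \<F> \<W> (scale c q + scale c r) = scale c q" for c
        using r.projection_along_low[OF span_scale[OF qr(2)] span_scale] rW unfolding F W by blast
      have "br (g ! ?l) x = scale eigval (br (g ! ?l) x0)"
        using assms(14) by (simp add: x0_def)
      then have "scale eigval q = scale eigval (g ! ?l) + (if 0 < ?l then g ! (?l - 1) else 0)"
        using T[OF l] proj[of eigval] qr(1) by (simp add: scale_right_distrib)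
      then have "scale (1 / eigval) (scale eigval q)
          = scale (1 / eigval) (scale eigval (g ! ?l) + (if 0 < ?l then g ! (?l - 1) else 0))"
        by (rule arg_cong)
      then have q: "q = g ! ?l + (if 0 < ?l then scale (1 / eigval) (g ! (?l - 1)) else 0)"
        using assms(14) by (simp add: scale_right_distrib split: if_splits)
      have "projection_along \<F> \<W> (br (h j) x0) = scale ?c q"
        using proj[of ?c] qr(1) by (simp add: h_def scale_right_distrib)
      also have "\<dots> = h j + (if j < k then h (j + 1) else 0)"
        unfolding q using j by (simp add: h_def scale_right_distrib)
      finally show ?thesis unfolding F W .
    qed
  qed
  then interpret s0: mu1_jordan_extension scale br m k e f0 x0 N .
  obtain e' where e': "mu1_jordan_extension scale br m k e' f0 x0 N" "br (e' 1) x0 \<in> span (e' ` {2..m})"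
    using s0.normalise_e1 .
  then interpret s1: mu1_jordan_extension scale br m k e' f0 x0 N by blast
  obtain x' \<eta> where x': "mu1_jordan_extension scale br m k e' f0 x' N" "br (e' 1) x' \<in> span (e' ` {2..m})"
    "br x' (e' 1) = 0" "br x' x' = scale \<eta> (e' m)"
    using s1.normalise_x[OF e'(2)] .
  then interpret s2: mu1_jordan_extension scale br m k e' f0 x' N by blast
  obtain a f' where f': "mu1_extension scale br m k e' f' x' N" "extension_table m k a e' f' x'"
    using s2.extension_table_if_normalised[OF x'(2-4)] .
  then show ?thesis
    using mu1_extension.ordered_basis_UNIV[OF f'(1)] unfolding m_def by blast
qed

end
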